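(* Let $\mathbf{d}$ be a distance on a set $X$ and let $(x_\lambda)\subseteq X$ be a $\mathbf{d}$-Cauchy net. If $\mathbf{d}^\bullet\precapprox\mathbf{I}$, i.e. $\lim_{r\to0}\mathbf{d}^\bullet(r)=0$, then there is a $\leq^{\mathbf{d}}$-directed $Y\subseteq X$ with $$Y\mathbf{d}=(x_\lambda)\mathbf{d}\qquad\text{and}\qquad\mathbf{d}Y=\mathbf{d}(x_\lambda),$$ that is, for all $z\in X$, $\sup_{y\in Y}\mathbf{d}(y,z)=\lim_\lambda\mathbf{d}(x_\lambda,z)$ and $\inf_{y\in Y}\mathbf{d}(z,y)=\lim_\lambda\mathbf{d}(z,x_\lambda)$.
   Context: A distance on $X$ is a function $\mathbf{d}:X\times X\to[0,\infty]$ with $\mathbf{d}(x,y)\leq\mathbf{d}(x,z)+\mathbf{d}(z,y)$ for all $x,y,z\in X$ (neither symmetry nor $\mathbf{d}(x,x)=0$ is required). In $[0,\infty]$, $\inf\emptyset=\infty$ and $\sup\emptyset=0$. A net is a family $(x_\lambda)_{\lambda\in\Lambda}$ indexed by a nonempty set $\Lambda$ with a transitive (possibly non-reflexive) relation $\prec$ such that for all $\gamma,\delta\in\Lambda$ there is $\lambda$ with $\gamma,\delta\prec\lambda$. Limits are taken with "eventually" meaning "for all $\lambda\succ\alpha$, for some $\alpha$". The net is $\mathbf{d}$-Cauchy if for every $\epsilon>0$ there is $\alpha$ such that $\mathbf{d}(x_\gamma,x_\delta)<\epsilon$ whenever $\alpha\prec\gamma\prec\delta$. For a $\mathbf{d}$-Cauchy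 net the limits $\lim_\lambda\mathbf{d}(x_\lambda,z)$ and $\lim_\lambda\mathbf{d}(z,x_\lambda)$ exist in $[0,\infty]$ for every $z\in X$. $x\leq^{\mathbf{d}}y$ iff $\mathbf{d}(x,y)=0$. $Y\subseteq X$ is $\leq^{\mathbf{d}}$-directed if for every finite $F\subseteq Y$ there is $y\in Y$ with $z\leq^{\mathbf{d}}y$ for all $z\in F$. With $x^\bullet_r=\{z\in X:\mathbf{d}(x,z)<r\}$, and $y\leq^{\mathbf{d}}x^\bullet_r$ meaning $y\leq^{\mathbf{d}}z$ for all $z\in x^\bullet_r$, define $\mathbf{d}^\bullet:[0,\infty]\to[0,\infty]$ by $$\mathbf{d}^\bullet(r)=\sup_{x\in X}\ \inf_{y\leq^{\mathbf{d}}x^\bullet_r}\mathbf{d}(x,y).$$ $\mathbf{I}$ is the identity on $[0,\infty]$, and $f\precapprox g$ means $\sup\{f(s):g(s)\leq r\}\to0$ as $r\to0$. *)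

theory Defs
  imports "HOL-Library.Extended_Nonnegative_Real"
begin

definition distance_on :: "'a set \<Rightarrow> ('a \<Rightarrow> 'a \<Rightarrow> ennreal) \<Rightarrow> bool" where
  "distance_on X d \<longleftrightarrow> (\<forall>x\<in>X. \<forall>y\<in>X. \<forall>z\<in>X. d x y \<le> d x z + d z y)"

definition dist_le :: "('a \<Rightarrow> 'a \<Rightarrow> ennreal) \<Rightarrow> 'a \<Rightarrow> 'a \<Rightarrow> bool" where
  "dist_le d x y \<longleftrightarrow> d x y = 0"

text \<open>The case \<open>F = {}\<close> forces a directed set to be nonempty.\<close>

definition dist_directed :: "('a \<Rightarrow> 'a \<Rightarrow> ennreal) \<Rightarrow> 'a set \<Rightarrow> bool" where
  "dist_directed d Y \<longleftrightarrow> (\<forall>F. finite F \<and> F \<subseteq> Y \<longrightarrow> (\<exists>y\<in>Y. \<forall>z\<in>F. dist_le d z y))"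

definition net_index :: "'i set \<Rightarrow> ('i \<Rightarrow> 'i \<Rightarrow> bool) \<Rightarrow> bool" where
  "net_index \<Lambda> prec \<longleftrightarrow>
     \<Lambda> \<noteq> {} \<and> transp_on \<Lambda> prec \<and>
     (\<forall>\<gamma>\<in>\<Lambda>. \<forall>\<delta>\<in>\<Lambda>. \<exists>l\<in>\<Lambda>. prec \<gamma> l \<and> prec \<delta> l)"

definition net_filter :: "'i set \<Rightarrow> ('i \<Rightarrow> 'i \<Rightarrow> bool) \<Rightarrow> 'i filter" where
  "net_filter \<Lambda> prec = (INF \<alpha>\<in>\<Lambda>. principal {l \<in> \<Lambda>. prec \<alpha> l})"

lemma eventually_net_filter:
  assumes "net_index \<Lambda> prec"
  shows "eventually P (net_filter \<Lambda> prec) \<longleftrightarrow> (\<exists>\<alpha>\<in>\<Lambda>. \<forall>l\<in>\<Lambda>. prec \<alpha> l \<longrightarrow> P l)"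
proof -
  have "eventually P (net_filter \<Lambda> prec) \<longleftrightarrow>
      (\<exists>\<alpha>\<in>\<Lambda>. eventually P (principal {l \<in> \<Lambda>. prec \<alpha> l}))"
    unfolding net_filter_def
  proof (rule eventually_INF_base)
    show "\<Lambda> \<noteq> {}" using assms by (simp add: net_index_def)
    fix a b assume ab: "a \<in> \<Lambda>" "b \<in> \<Lambda>"
    then obtain l where l: "l \<in> \<Lambda>" "prec a l" "prec b l"
      using assms by (auto simp: net_index_def)
    have "{k \<in> \<Lambda>. prec l k} \<subseteq> {k \<in> \<Lambda>. prec a k} \<inter> {k \<in> \<Lambda>. prec b k}"
      using assms ab l by (auto simp: net_index_def dest: transp_onD)
    then show "\<exists>x\<in>\<Lambda>. principal {k \<in> \<Lambda>. prec x k}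
        \<le> inf (principal {k \<in> \<Lambda>. prec a k}) (principal {k \<in> \<Lambda>. prec b k})"
      using l(1) by auto
  qed
  then show ?thesis by (auto simp: eventually_principal)
qed

lemma net_filter_neq_bot: "net_index \<Lambda> prec \<Longrightarrow> net_filter \<Lambda> prec \<noteq> bot"
  by (auto simp: trivial_limit_def eventually_net_filter) (auto simp: net_index_def)

definition cauchy_net ::
  "('a \<Rightarrow> 'a \<Rightarrow> ennreal) \<Rightarrow> 'i set \<Rightarrow> ('i \<Rightarrow> 'i \<Rightarrow> bool) \<Rightarrow> ('i \<Rightarrow> 'a) \<Rightarrow> bool" where
  "cauchy_net d \<Lambda> prec x \<longleftrightarrow>
     (\<forall>\<epsilon>>0. \<exists>\<alpha>\<in>\<Lambda>. \<forall>\<gamma>\<in>\<Lambda>. \<forall>\<delta>\<in>\<Lambda>. prec \<alpha> \<gamma> \<and> prec \<gamma> \<delta> \<longrightarrow> d (x \<gamma>) (x \<delta>) < \<epsilon>)"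

definition upper_ball :: "'a set \<Rightarrow> ('a \<Rightarrow> 'a \<Rightarrow> ennreal) \<Rightarrow> 'a \<Rightarrow> ennreal \<Rightarrow> 'a set" where
  "upper_ball X d x r = {z \<in> X. d x z < r}"

text \<open>In \<^typ>\<open>ennreal\<close>, \<open>Inf {} = top\<close> and \<open>Sup {} = 0\<close>.\<close>

definition d_bullet :: "'a set \<Rightarrow> ('a \<Rightarrow> 'a \<Rightarrow> ennreal) \<Rightarrow> ennreal \<Rightarrow> ennreal" where
  "d_bullet X d r =
     (SUP x\<in>X. INF y\<in>{y \<in> X. \<forall>z\<in>upper_ball X d x r. dist_le d y z}. d x y)"

definition precapprox :: "('b \<Rightarrow> ennreal) \<Rightarrow> ('b \<Rightarrow> ennreal) \<Rightarrow> bool" where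
  "precapprox f g \<longleftrightarrow> ((\<lambda>r. SUP s\<in>{s. g s \<le> r}. f s) \<longlongrightarrow> 0) (at_right 0)"

end

theory Submission imports Defs begin

text \<open>Take for \<open>Y\<close> the points that lie below a ball of one fixed radius around \<open>x l\<close>, for all late
  \<open>l\<close>. The hypothesis on \<open>d_bullet\<close> provides, for late \<open>l\<close>, points of \<open>Y\<close> at a small distance from
  \<open>x l\<close>. Such a point lies in the balls that belong to finitely many given elements of \<open>Y\<close>, hence
  above these elements. A ball around a late \<open>x l\<close> contains all later points of the net, so every
  element of \<open>Y\<close> is eventually below \<open>x l\<close>. The two limits follow from the triangle inequality.\<close>

text \<open>Supplies the error term \<open>e\<close> of the two limit proofs. It also covers
  \<open>b = top\<close>, where the gap is not a matter of finite arithmetic.\<close>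

lemma ennreal_obtain_gap:
  fixes a b :: ennreal
  assumes "a < b"
  obtains e where "0 < e" "a + e < b"
proof -
  obtain c where c: "a < c" "c < b" using dense[OF assms] by blast
  have "0 < c - a" using c by (simp add: diff_gt_0_iff_gt_ennreal)
  moreover have "a + (c - a) = c"
    using c diff_add_cancel_ennreal[of a c] by (simp add: add.commute)
  ultimately show ?thesis using that c by metis
qed

lemma ennreal_obtain_half:
  fixes t :: ennreal
  assumes "0 < t"
  obtains s where "0 < s" "s + s \<le> t"
proof -
  obtain c where c: "0 < c" "c < t" using dense[OF assms] by blast
  then obtain e where e: "0 < e" "c + e < t" using ennreal_obtain_gap by blast
  have "min c e + min c e \<le> c + e" by (intro add_mono) auto
  then show ?thesis using that[of "min c e"] c e by (auto simp: order.strict_implies_order)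
qed

lemma distance_onD:
  "distance_on X d \<Longrightarrow> x \<in> X \<Longrightarrow> y \<in> X \<Longrightarrow> z \<in> X \<Longrightarrow> d x y \<le> d x z + d z y"
  by (auto simp: distance_on_def)

text \<open>Since \<open>d_bullet\<close> is a supremum over all centres, a single radius
  \<open>t\<close> works for every \<open>u\<close>. An infimum below \<open>e\<close> is undercut
  by an actual point, which is the witness \<open>y\<close>.\<close>

lemma precapprox_d_bulletE:
  assumes "precapprox (d_bullet X d) (\<lambda>r. r)" "0 < e"
  obtains t where "0 < t"
    and "\<And>u. u \<in> X \<Longrightarrow> \<exists>y\<in>X. d u y < e \<and> (\<forall>z\<in>upper_ball X d u t. dist_le d y z)"
proof -
  have "eventually (\<lambda>r. (SUP s\<in>{s. s \<le> r}. d_bullet X d s) < e) (at_right 0)"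
    using assms by (auto simp: precapprox_def dest: order_tendstoD(2))
  then obtain b where b: "0 < b" "\<And>r. 0 < r \<Longrightarrow> r < b \<Longrightarrow> (SUP s\<in>{s. s \<le> r}. d_bullet X d s) < e"
    using eventually_at_right[of "0::ennreal" top] by auto
  obtain t where t: "0 < t" "t < b" using dense[OF b(1)] by blast
  have "d_bullet X d t \<le> (SUP s\<in>{s. s \<le> t}. d_bullet X d s)" by (rule SUP_upper) simp
  also have "\<dots> < e" using b t by blast
  finally have bullet: "d_bullet X d t < e" .
  have "\<exists>y\<in>X. d u y < e \<and> (\<forall>z\<in>upper_ball X d u t. dist_le d y z)" if "u \<in> X" for u
  proof -
    have "(INF y\<in>{y \<in> X. \<forall>z\<in>upper_ball X d u t. dist_le d y z}. d u y) \<le> d_bullet X d t"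
      unfolding d_bullet_def using that by (rule SUP_upper)
    from order.strict_trans1[OF this bullet] show ?thesis by (auto simp: INF_less_iff)
  qed
  with t show ?thesis using that by blast
qed

text \<open>The radius is chosen before the index: it must not shrink along the net, so that
  finitely many elements can share one positive radius.\<close>

definition stable_below ::
  "'a set \<Rightarrow> ('a \<Rightarrow> 'a \<Rightarrow> ennreal) \<Rightarrow> 'i filter \<Rightarrow> ('i \<Rightarrow> 'a) \<Rightarrow> 'a set" where
  "stable_below X d F x = {y \<in> X. \<exists>r>0. \<forall>\<^sub>F l in F. \<forall>z\<in>upper_ball X d (x l) r. dist_le d y z}"

context
  fixes X :: "'a set" and d :: "'a \<Rightarrow> 'a \<Rightarrow> ennreal"
    and \<Lambda> :: "'i set" and prec :: "'i \<Rightarrow> 'i \<Rightarrow> bool" and x :: "'i \<Rightarrow> 'a"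
  assumes dist: "distance_on X d"
    and net: "net_index \<Lambda> prec"
    and x_in: "x ` \<Lambda> \<subseteq> X"
    and cauchy: "cauchy_net d \<Lambda> prec x"
begin

lemma eventually_in_index: "\<forall>\<^sub>F l in net_filter \<Lambda> prec. l \<in> \<Lambda>"
  using net by (auto simp: eventually_net_filter net_index_def)

lemma eventually_prec:
  assumes "l \<in> \<Lambda>" shows "\<forall>\<^sub>F k in net_filter \<Lambda> prec. k \<in> \<Lambda> \<and> prec l k"
  using assms by (auto simp: eventually_net_filter[OF net])

lemma eventually_tail_in_upper_ball:
  assumes "0 < e"
  shows "\<forall>\<^sub>F l in net_filter \<Lambda> prec. \<forall>k\<in>\<Lambda>. prec l k \<longrightarrow> x k \<in> upper_ball X d (x l) e"
proof -
  obtain a where "a \<in> \<Lambda>" "\<forall>l\<in>\<Lambda>. \<forall>k\<in>\<Lambda>. prec a l \<and> prec l k \<longrightarrow> d (x l) (x k) < e"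
    using cauchy assms unfolding cauchy_net_def by meson
  then have "\<forall>l\<in>\<Lambda>. prec a l \<longrightarrow> (\<forall>k\<in>\<Lambda>. prec l k \<longrightarrow> x k \<in> upper_ball X d (x l) e)"
    using x_in by (auto simp: upper_ball_def)
  with \<open>a \<in> \<Lambda>\<close> show ?thesis by (auto simp: eventually_net_filter[OF net])
qed

text \<open>One late index \<open>l\<close> suffices: the ball around \<open>x l\<close> already
  contains every later point of the net, so the distance from \<open>y\<close> becomes exactly 0,
  not merely small.\<close>

lemma stable_below_eventually_le:
  assumes "y \<in> stable_below X d (net_filter \<Lambda> prec) x"
  shows "\<forall>\<^sub>F l in net_filter \<Lambda> prec. d y (x l) = 0"
proof -
  let ?F = "net_filter \<Lambda> prec"
  obtain r where r: "0 < r" "\<forall>\<^sub>F l in ?F. \<forall>z\<in>upper_ball X d (x l) r. dist_le d y z"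
    using assms by (auto simp: stable_below_def)
  obtain l where l: "l \<in> \<Lambda>" "\<forall>z\<in>upper_ball X d (x l) r. dist_le d y z"
      "\<forall>k\<in>\<Lambda>. prec l k \<longrightarrow> x k \<in> upper_ball X d (x l) r"
    using eventually_happens'[OF net_filter_neq_bot[OF net]
        eventually_conj[OF eventually_in_index
          eventually_conj[OF r(2) eventually_tail_in_upper_ball[OF r(1)]]]] by blast
  show ?thesis
    using eventually_prec[OF l(1)] by eventually_elim (use l in \<open>auto simp: dist_le_def\<close>)
qed

text \<open>By the triangle inequality, the \<open>s\<close>-balls around all points after
  \<open>l\<close> lie inside the \<open>t\<close>-ball around \<open>x l\<close>. Thus a condition
  at one index spreads to a whole tail, at the cost of halving the radius.\<close>

lemma stable_belowI:
  assumes l: "l \<in> \<Lambda>" and y: "y \<in> X" and s: "0 < s" "s + s \<le> t"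
    and tail: "\<forall>k\<in>\<Lambda>. prec l k \<longrightarrow> x k \<in> upper_ball X d (x l) s"
    and below: "\<forall>z\<in>upper_ball X d (x l) t. dist_le d y z"
  shows "y \<in> stable_below X d (net_filter \<Lambda> prec) x"
proof -
  have "\<forall>z\<in>upper_ball X d (x k) s. dist_le d y z" if k: "k \<in> \<Lambda>" "prec l k" for k
  proof
    fix z assume z: "z \<in> upper_ball X d (x k) s"
    have "d (x l) z \<le> d (x l) (x k) + d (x k) z"
      using x_in l k z by (intro distance_onD[OF dist]) (auto simp: upper_ball_def)
    also have "\<dots> < s + s"
      using tail k z by (intro add_strict_mono) (auto simp: upper_ball_def)
    also note s(2)
    finally show "dist_le d y z" using below z by (auto simp: upper_ball_def)
  qed
  then have "\<forall>\<^sub>F k in net_filter \<Lambda> prec. \<forall>z\<in>upper_ball X d (x k) s. dist_le d y z"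
    using eventually_prec[OF l] by (auto elim: eventually_mono)
  with y s show ?thesis by (auto simp: stable_below_def)
qed

context
  assumes bullet: "precapprox (d_bullet X d) (\<lambda>r. r)"
begin

text \<open>Here both hypotheses meet: \<open>bullet\<close> gives a point near \<open>x l\<close>
  and below its \<open>t\<close>-ball, and the Cauchy condition for half of \<open>t\<close> makes
  that point stable.\<close>

lemma eventually_near_stable_below:
  assumes "0 < e"
  shows "\<forall>\<^sub>F l in net_filter \<Lambda> prec. \<exists>y\<in>stable_below X d (net_filter \<Lambda> prec) x. d (x l) y < e"
proof -
  obtain t where t: "0 < t"
    "\<And>u. u \<in> X \<Longrightarrow> \<exists>y\<in>X. d u y < e \<and> (\<forall>z\<in>upper_ball X d u t. dist_le d y z)"
    using precapprox_d_bulletE[OF bullet assms] by blast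
  obtain s where s: "0 < s" "s + s \<le> t" using ennreal_obtain_half[OF t(1)] .
  from eventually_in_index eventually_tail_in_upper_ball[OF s(1)] show ?thesis
  proof eventually_elim
    case (elim l)
    then obtain y where "y \<in> X" "d (x l) y < e" "\<forall>z\<in>upper_ball X d (x l) t. dist_le d y z"
      using t(2) x_in by blast
    with stable_belowI[OF elim(1) _ s elim(2)] show ?case by blast
  qed
qed

lemma dist_directed_stable_below:
  "dist_directed d (stable_below X d (net_filter \<Lambda> prec) x)"
  unfolding dist_directed_def
proof (intro allI impI, elim conjE)
  let ?F = "net_filter \<Lambda> prec" and ?Y = "stable_below X d (net_filter \<Lambda> prec) x"
  fix A assume A: "finite A" "A \<subseteq> ?Y"
  have "\<forall>w\<in>A. \<exists>r. 0 < r \<and> (\<forall>\<^sub>F l in ?F. \<forall>z\<in>upper_ball X d (x l) r. dist_le d w z)"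
    using A by (auto simp: stable_below_def)
  from bchoice[OF this] obtain \<rho> where \<rho>: "\<And>w. w \<in> A \<Longrightarrow> 0 < \<rho> w"
    "\<And>w. w \<in> A \<Longrightarrow> \<forall>\<^sub>F l in ?F. \<forall>z\<in>upper_ball X d (x l) (\<rho> w). dist_le d w z"
    by blast
  \<comment> \<open>The extra 1 keeps \<open>e\<close> defined and positive for empty
    \<open>A\<close>; in that case the argument shows that the set has an element.\<close>
  define e where "e = Min (insert 1 (\<rho> ` A))"
  have e: "0 < e" "\<And>w. w \<in> A \<Longrightarrow> e \<le> \<rho> w" using A \<rho>(1) by (auto simp: e_def)
  have "\<forall>\<^sub>F l in ?F. \<forall>w\<in>A. \<forall>z\<in>upper_ball X d (x l) (\<rho> w). dist_le d w z"
    using A(1) \<rho>(2) by (simp add: eventually_ball_finite_distrib)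
  from eventually_happens'[OF net_filter_neq_bot[OF net]
      eventually_conj[OF this eventually_near_stable_below[OF e(1)]]]
  obtain l y where "\<forall>w\<in>A. \<forall>z\<in>upper_ball X d (x l) (\<rho> w). dist_le d w z" "y \<in> ?Y" "d (x l) y < e"
    by blast
  \<comment> \<open>As \<open>e\<close> is at most each \<open>\<rho> w\<close>, the one point
    \<open>y\<close> lies in all these balls at once.\<close>
  moreover from this have "y \<in> upper_ball X d (x l) (\<rho> w)" if "w \<in> A" for w
    using e(2)[OF that] by (auto simp: upper_ball_def stable_below_def)
  ultimately show "\<exists>y\<in>?Y. \<forall>w\<in>A. dist_le d w y" by blast
qed

text \<open>For the lower bound, each \<open>y\<close> is eventually at distance 0 from
  \<open>y\<close> to \<open>x l\<close>, so \<open>d y z\<close> is at most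
  \<open>d (x l) z\<close>. For the upper bound, a detour from \<open>x l\<close> through a nearby
  \<open>y\<close> costs less than \<open>e\<close>.\<close>

lemma tendsto_SUP_stable_below:
  assumes z: "z \<in> X"
  shows "((\<lambda>l. d (x l) z) \<longlongrightarrow> (SUP y\<in>stable_below X d (net_filter \<Lambda> prec) x. d y z))
    (net_filter \<Lambda> prec)"
    (is "(_ \<longlongrightarrow> ?S) ?F")
proof (rule order_tendstoI)
  fix a assume "a < ?S"
  then obtain y where y: "y \<in> stable_below X d ?F x" "a < d y z" by (auto simp: less_SUP_iff)
  from stable_below_eventually_le[OF y(1)] eventually_in_index
  show "\<forall>\<^sub>F l in ?F. a < d (x l) z"
  proof eventually_elim
    case (elim l)
    then have "d y z \<le> d y (x l) + d (x l) z"
      using y z x_in by (intro distance_onD[OF dist]) (auto simp: stable_below_def)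
    with elim y(2) show ?case by (simp add: order.strict_trans2)
  qed
next
  fix a assume "?S < a"
  then obtain e where e: "0 < e" "?S + e < a" by (rule ennreal_obtain_gap)
  from eventually_near_stable_below[OF e(1)] eventually_in_index
  show "\<forall>\<^sub>F l in ?F. d (x l) z < a"
  proof eventually_elim
    case (elim l)
    then obtain y where y: "y \<in> stable_below X d ?F x" "d (x l) y < e" by blast
    have "d (x l) z \<le> d (x l) y + d y z"
      using y z x_in elim by (intro distance_onD[OF dist]) (auto simp: stable_below_def)
    also have "\<dots> \<le> e + ?S" using y by (intro add_mono SUP_upper) auto
    also have "\<dots> < a" using e by (simp add: add.commute)
    finally show ?case .
  qed
qed

text \<open>The two ingredients swap roles: nearby points of the set now give the lower bound, and
  points eventually below the net give the upper bound.\<close>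

lemma tendsto_INF_stable_below:
  assumes z: "z \<in> X"
  shows "((\<lambda>l. d z (x l)) \<longlongrightarrow> (INF y\<in>stable_below X d (net_filter \<Lambda> prec) x. d z y))
    (net_filter \<Lambda> prec)"
    (is "(_ \<longlongrightarrow> ?I) ?F")
proof (rule order_tendstoI)
  fix a assume "a < ?I"
  then obtain e where e: "0 < e" "a + e < ?I" by (rule ennreal_obtain_gap)
  from eventually_near_stable_below[OF e(1)] eventually_in_index
  show "\<forall>\<^sub>F l in ?F. a < d z (x l)"
  proof eventually_elim
    case (elim l)
    then obtain y where y: "y \<in> stable_below X d ?F x" "d (x l) y < e" by blast
    have "a + e < ?I" by (fact e)
    also have "?I \<le> d z y" using y(1) by (rule INF_lower)
    also have "\<dots> \<le> d z (x l) + d (x l) y"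
      using y z x_in elim by (intro distance_onD[OF dist]) (auto simp: stable_below_def)
    also have "\<dots> \<le> d z (x l) + e" using y by (intro add_mono) auto
    \<comment> \<open>The term \<open>e\<close> is removed by contraposition:
      \<open>d z (x l) \<le> a\<close> would remain true after adding \<open>e\<close> to both
      sides.\<close>
    finally show ?case by (meson add_right_mono leD leI)
  qed
next
  fix a assume "?I < a"
  then obtain y where y: "y \<in> stable_below X d ?F x" "d z y < a" by (auto simp: INF_less_iff)
  from stable_below_eventually_le[OF y(1)] eventually_in_index
  show "\<forall>\<^sub>F l in ?F. d z (x l) < a"
  proof eventually_elim
    case (elim l)
    then have "d z (x l) \<le> d z y + d y (x l)"
      using y z x_in by (intro distance_onD[OF dist]) (auto simp: stable_below_def)
    with elim y(2) show ?case by (simp add: order.strict_trans1)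
  qed
qed

end

end

theorem theorem1:
  fixes X :: "'a set" and d :: "'a \<Rightarrow> 'a \<Rightarrow> ennreal"
    and \<Lambda> :: "'i set" and prec :: "'i \<Rightarrow> 'i \<Rightarrow> bool" and x :: "'i \<Rightarrow> 'a"
  assumes "distance_on X d"
    and "net_index \<Lambda> prec"
    and "x ` \<Lambda> \<subseteq> X"
    and "cauchy_net d \<Lambda> prec x"
    and "precapprox (d_bullet X d) (\<lambda>r. r)"
  shows "\<exists>Y. Y \<subseteq> X \<and> dist_directed d Y \<and>
    (\<forall>z\<in>X. ((\<lambda>l. d (x l) z) \<longlongrightarrow> (SUP y\<in>Y. d y z)) (net_filter \<Lambda> prec)) \<and>
    (\<forall>z\<in>X. ((\<lambda>l. d z (x l)) \<longlongrightarrow> (INF y\<in>Y. d z y)) (net_filter \<Lambda> prec))"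
proof (intro exI[of _ "stable_below X d (net_filter \<Lambda> prec) x"] conjI ballI)
  show "stable_below X d (net_filter \<Lambda> prec) x \<subseteq> X" by (auto simp: stable_below_def)
qed (rule dist_directed_stable_below[OF assms] tendsto_SUP_stable_below[OF assms]
    tendsto_INF_stable_below[OF assms], assumption?)+

end
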